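(* Let $k\ge 1$ be an integer. Then for every $s\in\mathbb{C}$ with $\operatorname{Re}(s)>1-\frac1k$, $$\Gamma_{t^k}(s+1)=\mathcal{B}(s)\,\Gamma_{t^k}(s).$$
   Context: For an integer $k\ge1$ and $\operatorname{Re}(s)>1-\frac1k$, define $\Gamma_{t^k}(s):=\int_0^\infty t^{k(s-1)}e^{-t}\,dt$, where $t^z:=e^{z\ln t}$ with the real logarithm for $t>0$. Define the polynomial $\mathcal{B}(s):=ks(ks-1)(ks-2)\cdots(ks-(k-1))$ (depending on $k$). *)

theory Defs
  imports "HOL-Analysis.Analysis"
begin

text \<open>
  For \<open>t > 0\<close> the complex \<open>powr\<close> uses the principal logarithm, which agrees with the real
  logarithm there, so \<open>of_real t powr z = exp (z * of_real (ln t))\<close>. The integral is the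
  Lebesgue integral; for \<open>k \<ge> 1\<close> it converges absolutely iff
  \<open>Re s > 1 - 1 / k\<close>, and elsewhere the defined value is the default \<open>0\<close>.
\<close>

definition Gamma_tpow :: "nat \<Rightarrow> complex \<Rightarrow> complex" where
  "Gamma_tpow k s =
     (LBINT t:{0<..}. complex_of_real t powr (of_nat k * (s - 1)) * complex_of_real (exp (- t)))"

definition B_poly :: "nat \<Rightarrow> complex \<Rightarrow> complex" where
  "B_poly k s = (\<Prod>j<k. of_nat k * s - of_nat j)"

end

theory Submission
  imports Defs
begin

text \<open>
  The integrand \<open>t powr (k (s - 1)) * exp (- t)\<close> is that of Euler's integral for \<open>\<Gamma>\<close> at
  \<open>z = k (s - 1) + 1\<close>, and \<open>Re s > 1 - 1 / k\<close> says exactly that \<open>Re z > 0\<close>, so the integral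
  equals \<open>\<Gamma> z\<close> (lemma \<open>Gamma_tpow_eq_Gamma\<close>). Replacing \<open>s\<close> by \<open>s + 1\<close> moves \<open>z\<close> to
  \<open>z + k\<close>, and \<open>k\<close> applications of \<open>\<Gamma> (w + 1) = w * \<Gamma> w\<close> produce the factor
  \<open>z (z + 1) \<dots> (z + k - 1)\<close>. Its last entry is \<open>k s\<close>, and reading it backwards
  gives \<open>k s (k s - 1) \<dots> (k s - (k - 1))\<close> (lemma \<open>B_poly_eq_pochhammer\<close>).
\<close>

text \<open>
  The library states Euler's integral as a gauge integral. Absolute integrability turns it into a
  Lebesgue integral over the completed measure, and continuity of the integrand on the open
  half-line gives the Borel measurability with which the completion can be dropped.
\<close>

lemma Gamma_set_lebesgue_integral:
  fixes z :: complex
  assumes "Re z > 0"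
  shows "(LBINT t:{0<..}. complex_of_real t powr (z - 1) * complex_of_real (exp (- t))) = Gamma z"
proof -
  let ?f = "\<lambda>t. complex_of_real t powr (z - 1) * complex_of_real (exp (- t))"
  have f_eq: "?f = (\<lambda>t. complex_of_real t powr (z - 1) / complex_of_real (exp t))"
    by (simp add: exp_minus divide_inverse)
  have int: "?f absolutely_integrable_on {0<..}"
    unfolding f_eq by (rule absolutely_integrable_Gamma_integral'[OF assms])
  have "continuous_on {0<..} ?f"
    by (intro continuous_intros) auto
  then have meas: "(\<lambda>t. indicator {0<..} t *\<^sub>R ?f t) \<in> borel_measurable lborel"
    by (simp add: borel_measurable_continuous_on_indicator)
  have "(LBINT t:{0<..}. ?f t) = (LINT t:{0<..}|lebesgue. ?f t)"
    unfolding set_lebesgue_integral_def by (rule integral_completion[OF meas, symmetric])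
  also have "\<dots> = integral {0<..} ?f"
    by (rule set_lebesgue_integral_eq_integral(2)[OF int])
  also have "\<dots> = Gamma z"
    unfolding f_eq by (rule integral_unique[OF Gamma_integral_complex'[OF assms]])
  finally show ?thesis .
qed

lemma Gamma_tpow_eq_Gamma:
  assumes "Re (of_nat k * (s - 1) + 1) > 0"
  shows "Gamma_tpow k s = Gamma (of_nat k * (s - 1) + 1)"
  using Gamma_set_lebesgue_integral[OF assms] by (simp add: Gamma_tpow_def)

lemma B_poly_eq_pochhammer:
  "B_poly k s = pochhammer (of_nat k * (s - 1) + 1) k"
proof -
  have "B_poly k s = (\<Prod>i<k. of_nat k * s - of_nat (k - Suc i))"
    unfolding B_poly_def by (rule prod.nat_diff_reindex[symmetric])
  also have "\<dots> = (\<Prod>i<k. of_nat k * (s - 1) + 1 + of_nat i)"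
    by (intro prod.cong) (auto simp: of_nat_diff algebra_simps)
  finally show ?thesis
    by (simp add: pochhammer_prod atLeast0LessThan)
qed

theorem proposition4:
  fixes k :: nat and s :: complex
  assumes "k \<ge> 1" and "Re s > 1 - 1 / real k"
  shows "Gamma_tpow k (s + 1) = B_poly k s * Gamma_tpow k s"
proof -
  define z where "z = of_nat k * (s - 1) + 1"
  have "Re z > 0"
    using assms by (simp add: z_def field_simps)
  have shift: "of_nat k * (s + 1 - 1) + 1 = z + of_nat k"
    by (simp add: z_def algebra_simps)
  have "Gamma_tpow k (s + 1) = Gamma (z + of_nat k)"
    using Gamma_tpow_eq_Gamma[of k "s + 1"] \<open>Re z > 0\<close> unfolding shift by simp
  also have "\<dots> = pochhammer z k * Gamma z"
  proof -
    have "z \<notin> \<int>\<^sub>\<le>\<^sub>0"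
      using \<open>Re z > 0\<close> by (auto elim!: nonpos_Ints_cases)
    then show ?thesis
      by (simp add: pochhammer_Gamma Gamma_eq_zero_iff)
  qed
  also have "\<dots> = B_poly k s * Gamma_tpow k s"
    using Gamma_tpow_eq_Gamma[of k s] \<open>Re z > 0\<close>
    by (simp add: B_poly_eq_pochhammer z_def)
  finally show ?thesis .
qed

end
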